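(* For $\alpha\ge 0$, $\beta,\theta>0$ let $K_{\alpha,\beta,\theta}$ be the distribution function $$K_{\alpha,\beta,\theta}(x)=1-\frac{1}{\left(\frac{x}{\beta}+\alpha^\theta\right)^{1/\theta}+1-\alpha},\qquad x\ge 0.$$ Let $\alpha,\alpha_1\ge 0$ and $\theta,\theta_1>0$. Then: 1. If $\theta\le\theta_1$ and $\alpha(\theta_1-1)+\alpha_1(1-\theta)\ge 0$, then for every $\beta,\beta_1>0$, $K_{\alpha,\beta,\theta}\leq_c K_{\alpha_1,\beta_1,\theta_1}$. 2. If $\theta\ge\theta_1$ and $\alpha(\theta_1-1)+\alpha_1(1-\theta)\le 0$, then for every $\beta,\beta_1>0$, $K_{\alpha_1,\beta_1,\theta_1}\leq_c K_{\alpha,\beta,\theta}$.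
   Context: $F_1\leq_c F_2$ (convex transform order) means that $F_2^{-1}\circ F_1$ is convex (on the support of $F_1$; here on $[0,\infty)$). The quantile function of $K_{\alpha,\beta,\theta}$ is $K_{\alpha,\beta,\theta}^{-1}(u)=\beta\left(\left(\frac{1}{1-u}+\alpha-1\right)^\theta-\alpha^\theta\right)$, $u\in[0,1)$. *)

theory Defs
  imports "HOL-Analysis.Analysis"
begin

definition cdf_support :: "(real \<Rightarrow> real) \<Rightarrow> real set" where
  "cdf_support F = {x. \<forall>\<epsilon>>0. F (x - \<epsilon>) < F (x + \<epsilon>)}"

text \<open>
  For \<open>0 < u < 1\<close> and a distribution function \<open>F\<close> this is the usual left-continuous inverse
  \<open>inf {x. u \<le> F x}\<close>, whose value always lies in the support. Restricting the infimum to the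
  support only matters at \<open>u = 0\<close>, where it gives the left endpoint of the support
  instead of the infimum of the whole real line.
\<close>

definition quantile :: "(real \<Rightarrow> real) \<Rightarrow> real \<Rightarrow> real" where
  "quantile F u = Inf {x \<in> cdf_support F. u \<le> F x}"

definition convex_transform_le :: "(real \<Rightarrow> real) \<Rightarrow> (real \<Rightarrow> real) \<Rightarrow> bool"
    (infix "\<le>\<^sub>c" 50) where
  "F\<^sub>1 \<le>\<^sub>c F\<^sub>2 \<longleftrightarrow> convex_on (cdf_support F\<^sub>1) (quantile F\<^sub>2 \<circ> F\<^sub>1)"

text \<open>
  The distribution is concentrated on the nonnegative half-line, so its distribution function
  vanishes for \<open>x < 0\<close>. The convention \<open>0 powr \<theta> = 0\<close> agrees with \<open>0\<^sup>\<theta> = 0\<close> for \<open>\<theta> > 0\<close>.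
\<close>

definition K :: "real \<Rightarrow> real \<Rightarrow> real \<Rightarrow> real \<Rightarrow> real" where
  "K \<alpha> \<beta> \<theta> x =
     (if x < 0 then 0
      else 1 - 1 / ((x / \<beta> + \<alpha> powr \<theta>) powr (1 / \<theta>) + 1 - \<alpha>))"

text \<open>
  The general notions specialise as expected: the support is the nonnegative half-line
  and the quantile function has the expected closed form.
\<close>

context
  fixes \<alpha> \<beta> \<theta> :: real
  assumes \<alpha>: "\<alpha> \<ge> 0" and \<beta>: "\<beta> > 0" and \<theta>: "\<theta> > 0"
begin

lemma K_denominator:
  assumes "x \<ge> 0"
  shows "(x / \<beta> + \<alpha> powr \<theta>) powr (1 / \<theta>) + 1 - \<alpha> \<ge> 1"
proof -
  have "(\<alpha> powr \<theta>) powr (1 / \<theta>) \<le> (x / \<beta> + \<alpha> powr \<theta>) powr (1 / \<theta>)"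
    using assms \<beta> \<theta> by (intro powr_mono2) auto
  then show ?thesis using \<alpha> \<theta> by (simp add: powr_powr)
qed

lemma K_0: "K \<alpha> \<beta> \<theta> 0 = 0"
  using \<alpha> \<theta> by (simp add: K_def powr_powr)

lemma K_strict_mono:
  assumes "0 \<le> x" "x < y"
  shows "K \<alpha> \<beta> \<theta> x < K \<alpha> \<beta> \<theta> y"
proof -
  have "(x / \<beta> + \<alpha> powr \<theta>) powr (1 / \<theta>) < (y / \<beta> + \<alpha> powr \<theta>) powr (1 / \<theta>)"
    using assms \<beta> \<theta> by (intro powr_less_mono2) (auto simp: divide_strict_right_mono)
  then show ?thesis
    using assms K_denominator[of x] unfolding K_def
    by (auto intro!: divide_strict_left_mono mult_pos_pos)
qed

lemma cdf_support_K: "cdf_support (K \<alpha> \<beta> \<theta>) = {0..}"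
proof (intro set_eqI iffI)
  fix x :: real assume "x \<in> cdf_support (K \<alpha> \<beta> \<theta>)"
  then have *: "\<epsilon> > 0 \<Longrightarrow> K \<alpha> \<beta> \<theta> (x - \<epsilon>) < K \<alpha> \<beta> \<theta> (x + \<epsilon>)" for \<epsilon>
    by (simp add: cdf_support_def)
  show "x \<in> {0..}"
  proof (rule ccontr)
    assume "x \<notin> {0..}"
    then show False using *[of "- x / 2"] by (simp add: K_def)
  qed
next
  fix x :: real assume x: "x \<in> {0..}"
  have "K \<alpha> \<beta> \<theta> (x - \<epsilon>) < K \<alpha> \<beta> \<theta> (x + \<epsilon>)" if "\<epsilon> > 0" for \<epsilon>
  proof (cases "x - \<epsilon> < 0")
    case True
    then have "K \<alpha> \<beta> \<theta> (x - \<epsilon>) = K \<alpha> \<beta> \<theta> 0" by (simp add: K_0) (simp add: K_def)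
    then show ?thesis using K_strict_mono[of 0 "x + \<epsilon>"] x that by simp
  next
    case False
    then show ?thesis using K_strict_mono that by simp
  qed
  then show "x \<in> cdf_support (K \<alpha> \<beta> \<theta>)" by (simp add: cdf_support_def)
qed

lemma quantile_K:
  assumes "0 \<le> u" "u < 1"
  shows "quantile (K \<alpha> \<beta> \<theta>) u = \<beta> * ((1 / (1 - u) + \<alpha> - 1) powr \<theta> - \<alpha> powr \<theta>)"
    (is "_ = ?q")
proof -
  have u: "1 / (1 - u) \<ge> 1" using assms by (simp add: field_simps)
  have q0: "?q \<ge> 0"
    using \<alpha> \<beta> \<theta> u by (intro mult_nonneg_nonneg) (auto intro: powr_mono2)
  have "?q / \<beta> + \<alpha> powr \<theta> = (1 / (1 - u) + \<alpha> - 1) powr \<theta>" using \<beta> by simp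
  then have "(?q / \<beta> + \<alpha> powr \<theta>) powr (1 / \<theta>) = 1 / (1 - u) + \<alpha> - 1"
    using \<alpha> \<theta> u by (simp add: powr_powr)
  then have Kq: "K \<alpha> \<beta> \<theta> ?q = u" using q0 by (simp add: K_def)
  define q where "q = ?q"
  have "{x \<in> cdf_support (K \<alpha> \<beta> \<theta>). u \<le> K \<alpha> \<beta> \<theta> x} = {q..}"
  proof (intro set_eqI iffI)
    fix x assume "x \<in> {x \<in> cdf_support (K \<alpha> \<beta> \<theta>). u \<le> K \<alpha> \<beta> \<theta> x}"
    then have "0 \<le> x" "u \<le> K \<alpha> \<beta> \<theta> x" by (auto simp: cdf_support_K)
    then show "x \<in> {q..}"
      using K_strict_mono[of x q] Kq[folded q_def] by (cases "x < q") auto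
  next
    fix x assume "x \<in> {q..}"
    then have "q \<le> x" by simp
    then have "u \<le> K \<alpha> \<beta> \<theta> x"
      using K_strict_mono[of q x] Kq[folded q_def] q0[folded q_def] by (cases "q = x") auto
    then show "x \<in> {x \<in> cdf_support (K \<alpha> \<beta> \<theta>). u \<le> K \<alpha> \<beta> \<theta> x}"
      using \<open>q \<le> x\<close> q0[folded q_def] by (simp add: cdf_support_K)
  qed
  then show ?thesis by (simp add: quantile_def q_def)
qed

end

end

theory Submission
  imports Defs
begin

text \<open>
  In the variable \<open>t = (x / \<beta> + \<alpha> powr \<theta>) powr (1 / \<theta>) - \<alpha>\<close>, which increases with \<open>x\<close>, the
  derivative of the composed transform is a positive constant times
  \<open>(t + \<alpha>\<^sub>1) powr (\<theta>\<^sub>1 - 1) * (t + \<alpha>) powr (1 - \<theta>)\<close>. The logarithmic derivative of this product has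
  the sign of \<open>t * (\<theta>\<^sub>1 - \<theta>) + \<alpha> * (\<theta>\<^sub>1 - 1) + \<alpha>\<^sub>1 * (1 - \<theta>)\<close>, which the hypotheses make nonnegative.
  The second part is the first one with the two parameter triples exchanged.
\<close>

text \<open>Both points are limits of sequences in \<open>S\<close>, and the convexity inequality
  survives the limit by continuity. This serves to add the endpoint 0 to the open half-line.\<close>

lemma convex_on_closure:
  fixes f :: "'a::real_normed_vector \<Rightarrow> real"
  assumes convex: "convex_on S f" and cont: "continuous_on (closure S) f"
  shows "convex_on (closure S) f"
proof (rule convex_onI)
  show "convex (closure S)"
    using convex by (simp add: convex_on_def convex_closure)
next
  fix t :: real and x y
  assume t: "0 < t" "t < 1" and "x \<in> closure S" "y \<in> closure S"
  then obtain X Y where X: "\<And>n. X n \<in> S" "X \<longlonglongrightarrow> x" and Y: "\<And>n. Y n \<in> S" "Y \<longlonglongrightarrow> y"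
    unfolding closure_sequential by metis
  let ?Z = "\<lambda>n. (1 - t) *\<^sub>R X n + t *\<^sub>R Y n" and ?z = "(1 - t) *\<^sub>R x + t *\<^sub>R y"
  have Z: "?Z n \<in> S" for n
    using convex X(1) Y(1) t by (intro convexD) (auto simp: convex_on_def)
  have Zlim: "?Z \<longlonglongrightarrow> ?z"
    using X(2) Y(2) by (intro tendsto_intros)
  have flim: "(\<lambda>n. f (W n)) \<longlonglongrightarrow> f w" if "\<And>n. W n \<in> S" "W \<longlonglongrightarrow> w" for W w
  proof -
    have "w \<in> closure S" using that unfolding closure_sequential by blast
    then show ?thesis
      using cont that closure_subset[of S] unfolding continuous_on_sequentially comp_def by blast
  qed
  show "f ?z \<le> (1 - t) * f x + t * f y"
  proof (rule LIMSEQ_le)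
    show "(\<lambda>n. f (?Z n)) \<longlonglongrightarrow> f ?z" by (rule flim[OF Z Zlim])
    show "(\<lambda>n. (1 - t) * f (X n) + t * f (Y n)) \<longlonglongrightarrow> (1 - t) * f x + t * f y"
      by (intro tendsto_intros flim X Y)
    show "\<exists>N. \<forall>n\<ge>N. f (?Z n) \<le> (1 - t) * f (X n) + t * f (Y n)"
      using convex_onD[OF convex _ _ X(1) Y(1)] t by simp
  qed
qed

lemma convex_on_cong:
  assumes "\<And>x. x \<in> S \<Longrightarrow> f x = g x" and "convex_on S g"
  shows "convex_on S f"
  using assms unfolding convex_on_def by (simp add: convexD)

text \<open>The logarithm of the product has derivative
  \<open>(u * (p + q) + (p * b + q * a)) / ((u + a) * (u + b))\<close>, so the two sign hypotheses
  suffice for \<open>u > 0\<close>. Starting from \<open>0 < s\<close> keeps the logarithms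
  meaningful when \<open>a\<close> or \<open>b\<close> is 0.\<close>

lemma powr_product_mono:
  fixes a b p q :: real
  assumes "0 \<le> a" "0 \<le> b" "0 < s" "s \<le> t"
    and "0 \<le> p + q" "0 \<le> p * b + q * a"
  shows "(s + a) powr p * (s + b) powr q \<le> (t + a) powr p * (t + b) powr q"
proof -
  have "p * ln (s + a) + q * ln (s + b) \<le> p * ln (t + a) + q * ln (t + b)"
  proof (rule DERIV_nonneg_imp_nondecreasing[OF \<open>s \<le> t\<close>], intro exI conjI)
    fix u assume "s \<le> u" "u \<le> t"
    with assms have u: "u > 0" "u + a > 0" "u + b > 0" by auto
    show "((\<lambda>u. p * ln (u + a) + q * ln (u + b)) has_real_derivative
        p / (u + a) + q / (u + b)) (at u)"
      using u by (auto intro!: derivative_eq_intros)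
    have "p / (u + a) + q / (u + b) = (u * (p + q) + (p * b + q * a)) / ((u + a) * (u + b))"
      using u by (simp add: field_simps)
    then show "0 \<le> p / (u + a) + q / (u + b)"
      using u assms by simp
  qed
  then show ?thesis
    using assms by (simp add: powr_def flip: exp_add)
qed

text \<open>Up to a positive factor and an additive constant, this function is the second quantile
  function composed with the first distribution function.\<close>

lemma convex_on_powr_transform:
  fixes \<alpha> \<alpha>\<^sub>1 \<theta> \<theta>\<^sub>1 :: real
  assumes nonneg: "\<alpha> \<ge> 0" "\<alpha>\<^sub>1 \<ge> 0" and pos: "\<theta> > 0" "\<theta>\<^sub>1 > 0" "\<beta> > 0"
    and le: "\<theta> \<le> \<theta>\<^sub>1" "0 \<le> \<alpha> * (\<theta>\<^sub>1 - 1) + \<alpha>\<^sub>1 * (1 - \<theta>)"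
  shows "convex_on {0..} (\<lambda>x. ((x / \<beta> + \<alpha> powr \<theta>) powr (1 / \<theta>) - \<alpha> + \<alpha>\<^sub>1) powr \<theta>\<^sub>1)"
    (is "convex_on _ ?f")
proof -
  \<comment> \<open>For \<open>x \<ge> 0\<close> the difference \<open>w x - \<alpha>\<close> is the
    odds F / (1 - F) of F = \<open>K \<alpha> \<beta> \<theta>\<close> at \<open>x\<close>.\<close>
  define w where "w x = (x / \<beta> + \<alpha> powr \<theta>) powr (1 / \<theta>)" for x
  have w_mono: "w x < w y" if "0 \<le> x" "x < y" for x y
    unfolding w_def using that pos by (intro powr_less_mono2) (auto simp: divide_strict_right_mono)
  have w_0: "w 0 = \<alpha>"
    using nonneg pos by (simp add: w_def powr_powr)
  have w_gt: "w x > \<alpha>" if "x > 0" for x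
    using w_mono[of 0 x] that w_0 by simp
  have w_ge: "w x \<ge> \<alpha>" if "x \<ge> 0" for x
    using w_gt[of x] w_0 that by (cases "x = 0") auto
  have w_deriv: "(w has_real_derivative w x powr (1 - \<theta>) / (\<theta> * \<beta>)) (at x)" if "x > 0" for x
  proof -
    have z: "x / \<beta> + \<alpha> powr \<theta> > 0"
      using that pos by (intro add_pos_nonneg) auto
    \<comment> \<open>The inner base is \<open>w x\<close> to the power \<theta>, so the exponent
      1/\<theta> - 1 from the power rule becomes 1 - \<theta> on \<open>w x\<close>.\<close>
    have "1 / \<theta> * (1 - \<theta>) = 1 / \<theta> - 1" using pos by (simp add: field_simps)
    then have e: "w x powr (1 - \<theta>) = (x / \<beta> + \<alpha> powr \<theta>) powr (1 / \<theta> - 1)"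
      by (simp add: w_def powr_powr)
    have inner: "((\<lambda>x. x / \<beta> + \<alpha> powr \<theta>) has_real_derivative 1 / \<beta>) (at x)"
      using pos by (auto intro!: derivative_eq_intros)
    show ?thesis
      unfolding e using DERIV_chain2[OF has_real_derivative_powr[OF z, of "1 / \<theta>"] inner]
      by (simp add: w_def[abs_def])
  qed
  \<comment> \<open>The term \<open>- \<alpha> + \<alpha>\<close> stays uncancelled so that both
    bases are shifts of \<open>w x - \<alpha>\<close>, as \<open>powr_product_mono\<close>
    expects.\<close>
  define g where "g x = \<theta>\<^sub>1 / (\<theta> * \<beta>) *
    ((w x - \<alpha> + \<alpha>\<^sub>1) powr (\<theta>\<^sub>1 - 1) * (w x - \<alpha> + \<alpha>) powr (1 - \<theta>))" for x
  \<comment> \<open>The point 0 is left out because a base of \<open>powr\<close> vanishes there if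
    \<alpha> or \<open>\<alpha>\<^sub>1\<close> is 0, and the derivative may then fail to
    exist.\<close>
  have "convex_on {0<..} ?f"
  proof (rule convex_on_realI[where f' = g])
    show "connected {0::real<..}" by (simp add: convex_connected)
  next
    fix x :: real assume "x \<in> {0<..}"
    then have x: "x > 0" by simp
    have z: "w x - \<alpha> + \<alpha>\<^sub>1 > 0" using w_gt[OF x] nonneg by simp
    have inner: "((\<lambda>x. w x - \<alpha> + \<alpha>\<^sub>1) has_real_derivative w x powr (1 - \<theta>) / (\<theta> * \<beta>)) (at x)"
      using w_deriv[OF x] by (auto intro!: derivative_eq_intros)
    show "(?f has_real_derivative g x) (at x)"
      using DERIV_chain2[OF has_real_derivative_powr[OF z, of \<theta>\<^sub>1] inner]
      by (simp add: w_def g_def mult_ac)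
  next
    fix x y :: real assume "x \<in> {0<..}" "y \<in> {0<..}" "x \<le> y"
    then have "w x \<le> w y" "w x > \<alpha>"
      using w_mono[of x y] w_gt[of x] by (cases "x = y"; simp)+
    then show "g x \<le> g y"
      unfolding g_def using nonneg pos le
      by (intro mult_left_mono powr_product_mono) (auto simp: algebra_simps)
  qed
  \<comment> \<open>Positive exponents keep \<open>powr\<close> continuous even where its base is
    0.\<close>
  moreover have "continuous_on {0..} ?f"
  proof -
    have "continuous_on {0..} w"
      unfolding w_def using pos by (intro continuous_on_powr' continuous_intros) auto
    then have "continuous_on {0..} (\<lambda>x. (w x - \<alpha> + \<alpha>\<^sub>1) powr \<theta>\<^sub>1)"
      using pos nonneg w_ge by (intro continuous_on_powr' continuous_intros) auto
    then show ?thesis by (simp add: w_def)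
  qed
  ultimately show ?thesis
    using convex_on_closure[of "{0<..}" ?f] by simp
qed

text \<open>The closed form of the quantile leaves \<open>?f\<close> up to the shift by
  \<open>\<alpha>\<^sub>1 powr \<theta>\<^sub>1\<close> and the positive factor
  \<open>\<beta>\<^sub>1\<close>, both of which preserve convexity.\<close>

lemma convex_transform_le_K:
  assumes nonneg: "\<alpha> \<ge> 0" "\<alpha>\<^sub>1 \<ge> 0" and pos: "\<theta> > 0" "\<theta>\<^sub>1 > 0" "\<beta> > 0" "\<beta>\<^sub>1 > 0"
    and le: "\<theta> \<le> \<theta>\<^sub>1" "0 \<le> \<alpha> * (\<theta>\<^sub>1 - 1) + \<alpha>\<^sub>1 * (1 - \<theta>)"
  shows "K \<alpha> \<beta> \<theta> \<le>\<^sub>c K \<alpha>\<^sub>1 \<beta>\<^sub>1 \<theta>\<^sub>1"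
proof -
  let ?f = "\<lambda>x. ((x / \<beta> + \<alpha> powr \<theta>) powr (1 / \<theta>) - \<alpha> + \<alpha>\<^sub>1) powr \<theta>\<^sub>1"
  have "(quantile (K \<alpha>\<^sub>1 \<beta>\<^sub>1 \<theta>\<^sub>1) \<circ> K \<alpha> \<beta> \<theta>) x = \<beta>\<^sub>1 * (?f x + - (\<alpha>\<^sub>1 powr \<theta>\<^sub>1))" if "x \<in> {0..}" for x
  proof -
    define D where "D = (x / \<beta> + \<alpha> powr \<theta>) powr (1 / \<theta>) + 1 - \<alpha>"
    have x: "x \<ge> 0" using that by simp
    then have D: "D \<ge> 1" unfolding D_def by (intro K_denominator nonneg pos)
    have K: "K \<alpha> \<beta> \<theta> x = 1 - 1 / D" using x by (simp add: K_def D_def)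
    \<comment> \<open>\<open>D \<ge> 1\<close> places the level \<open>1 - 1 / D\<close> in [0, 1),
      the range of \<open>quantile_K\<close>; level 0 occurs at \<open>x = 0\<close>.\<close>
    have "quantile (K \<alpha>\<^sub>1 \<beta>\<^sub>1 \<theta>\<^sub>1) (1 - 1 / D) = \<beta>\<^sub>1 * ((D + \<alpha>\<^sub>1 - 1) powr \<theta>\<^sub>1 - \<alpha>\<^sub>1 powr \<theta>\<^sub>1)"
      using D nonneg pos by (subst quantile_K) auto
    then show ?thesis by (simp add: K D_def algebra_simps)
  qed
  moreover have "convex_on {0..} (\<lambda>x. \<beta>\<^sub>1 * (?f x + - (\<alpha>\<^sub>1 powr \<theta>\<^sub>1)))"
    using assms
    by (intro convex_on_cmul convex_on_add convex_on_powr_transform)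
      (auto simp: convex_on_const)
  ultimately show ?thesis
    unfolding convex_transform_le_def cdf_support_K[OF nonneg(1) pos(3,1)]
    by (metis (no_types, lifting) convex_on_cong)
qed

theorem theorem5p11:
  fixes \<alpha> \<alpha>\<^sub>1 \<theta> \<theta>\<^sub>1 :: real
  assumes "\<alpha> \<ge> 0" "\<alpha>\<^sub>1 \<ge> 0" "\<theta> > 0" "\<theta>\<^sub>1 > 0"
  shows "(\<theta> \<le> \<theta>\<^sub>1 \<and> \<alpha> * (\<theta>\<^sub>1 - 1) + \<alpha>\<^sub>1 * (1 - \<theta>) \<ge> 0 \<longrightarrow>
            (\<forall>\<beta>>0. \<forall>\<beta>\<^sub>1>0. K \<alpha> \<beta> \<theta> \<le>\<^sub>c K \<alpha>\<^sub>1 \<beta>\<^sub>1 \<theta>\<^sub>1)) \<and>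
         (\<theta> \<ge> \<theta>\<^sub>1 \<and> \<alpha> * (\<theta>\<^sub>1 - 1) + \<alpha>\<^sub>1 * (1 - \<theta>) \<le> 0 \<longrightarrow>
            (\<forall>\<beta>>0. \<forall>\<beta>\<^sub>1>0. K \<alpha>\<^sub>1 \<beta>\<^sub>1 \<theta>\<^sub>1 \<le>\<^sub>c K \<alpha> \<beta> \<theta>))"
  \<comment> \<open>Exchanging the triples negates the sign expression: \<open>\<alpha>\<^sub>1 *
    (\<theta> - 1) + \<alpha> * (1 - \<theta>\<^sub>1)\<close> is the negative of the original
    one.\<close>
  using convex_transform_le_K[of \<alpha> \<alpha>\<^sub>1 \<theta> \<theta>\<^sub>1] convex_transform_le_K[of \<alpha>\<^sub>1 \<alpha> \<theta>\<^sub>1 \<theta>] assms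
  by (auto simp: algebra_simps)

end
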